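(* Let $K$ be a field of characteristic $\neq 2$ and let $\mathcal{E}=I_1\oplus I_2$ be a decomposable power-associative nil evolution $K$-algebra, where $I_1,I_2$ are nonzero ideals. Let $$L_K(\mathcal{E})=\mathfrak{D}(I_1)\times\mathfrak{D}(I_2)\times\mathrm{Hom}^0(I_1,I_2)\times\mathrm{Hom}^0(I_2,I_1)$$ with multiplication $[(f,g,\ell,k),(f',g',\ell',k')]=(f'',g'',\ell'',k'')$ given by $f''=[f,f']+(k\circ\ell'-k'\circ\ell)$, $g''=[g,g']+(\ell\circ k'-\ell'\circ k)$, $\ell''=(\ell\circ f'-\ell'\circ f)+(g\circ\ell'-g'\circ\ell)$, $k''=(k\circ g'-k'\circ g)+(f\circ k'-f'\circ k)$. Then the map $\varphi:\mathfrak{D}(\mathcal{E})\to L_K(\mathcal{E})$, $d\mapsto(f_d,g_d,\ell_d,k_d)$, is an isomorphism of Lie algebras, where $f_d,\ell_d,g_d,k_d$ are the components of $d$: $d(x_1)=f_d(x_1)+\ell_d(x_1)$ with $f_d(x_1)\in I_1$, $\ell_d(x_1)\in I_2$ for $x_1\in I_1$, and $d(x_2)=g_d(x_2)+k_d(x_2)$ with $g_d(x_2)\in I_2$, $k_d(x_2)\in I_1$ for $x_2\in I_2$.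
   Context: An evolution $K$-algebra is a finite-dimensional commutative (not necessarily associative) $K$-algebra having a basis $\{e_1,\dots,e_n\}$ with $e_ie_j=0$ for $i\ne j$. It is power-associative if every subalgebra generated by one element is associative, and nil if for every $a$ some power $a^m$ is $0$ ($a^1=a$, $a^{k+1}=a^ka$). An algebra is decomposable if it is the direct sum of two nonzero ideals. A derivation of an algebra $A$ is a linear map $d:A\to A$ with $d(uv)=ud(v)+d(u)v$; $\mathfrak{D}(A)$ is the Lie algebra of derivations of $A$ with $[d,d']=d\circ d'-d'\circ d$. For ideals $I,J$: $\mathrm{Hom}^0(I,J)=\{h\in\mathrm{Hom}_K(I,J)\mid h(I^2)=0\text{ and }h(I)\subseteq\mathrm{ann}(J)\}$, where $I^2$ is the span of products of two elements of $I$ and $\mathrm{ann}(J)=\{x\in J: xJ=0\}$. *)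

theory Defs
  imports
    Complex_Main
    "HOL-Library.Function_Algebras"
    "HOL-Library.Product_Plus"
begin

section \<open>Evolution algebras\<close>

locale nonassoc_algebra = vector_space scale
  for scale :: "'k::field \<Rightarrow> 'v::ab_group_add \<Rightarrow> 'v" +
  fixes mul :: "'v \<Rightarrow> 'v \<Rightarrow> 'v"
  assumes mul_add_left: "mul (x + y) z = mul x z + mul y z"
    and mul_add_right: "mul x (y + z) = mul x y + mul x z"
    and mul_scale_left: "mul (scale c x) y = scale c (mul x y)"
    and mul_scale_right: "mul x (scale c y) = scale c (mul x y)"

definition evolution_algebra ::
  "('k::field \<Rightarrow> 'v::ab_group_add \<Rightarrow> 'v) \<Rightarrow> ('v \<Rightarrow> 'v \<Rightarrow> 'v) \<Rightarrow> bool" where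
  "evolution_algebra scale mul \<longleftrightarrow>
     nonassoc_algebra scale mul \<and>
     (\<forall>x y. mul x y = mul y x) \<and>
     (\<exists>B. finite B \<and> \<not> module.dependent scale B \<and> module.span scale B = UNIV \<and>
          (\<forall>e\<in>B. \<forall>e'\<in>B. e \<noteq> e' \<longrightarrow> mul e e' = 0))"

definition subalgebra ::
  "('k::field \<Rightarrow> 'v::ab_group_add \<Rightarrow> 'v) \<Rightarrow> ('v \<Rightarrow> 'v \<Rightarrow> 'v) \<Rightarrow> 'v set \<Rightarrow> bool" where
  "subalgebra scale mul S \<longleftrightarrow>
     module.subspace scale S \<and> (\<forall>x\<in>S. \<forall>y\<in>S. mul x y \<in> S)"

definition power_associative ::
  "('k::field \<Rightarrow> 'v::ab_group_add \<Rightarrow> 'v) \<Rightarrow> ('v \<Rightarrow> 'v \<Rightarrow> 'v) \<Rightarrow> bool" where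
  "power_associative scale mul \<longleftrightarrow>
     (\<forall>a. \<forall>x \<in> subalgebra scale mul hull {a}. \<forall>y \<in> subalgebra scale mul hull {a}.
          \<forall>z \<in> subalgebra scale mul hull {a}. mul (mul x y) z = mul x (mul y z))"

text \<open>There is no unit, so only exponents \<open>m \<ge> 1\<close> are meaningful here.\<close>

definition alg_power :: "('v \<Rightarrow> 'v \<Rightarrow> 'v) \<Rightarrow> 'v \<Rightarrow> nat \<Rightarrow> 'v" where
  "alg_power mul a m = ((\<lambda>x. mul x a) ^^ (m - 1)) a"

lemma alg_power_1: "alg_power mul a 1 = a"
  by (simp add: alg_power_def)

lemma alg_power_Suc: "m \<ge> 1 \<Longrightarrow> alg_power mul a (m + 1) = mul (alg_power mul a m) a"
  by (cases m) (simp_all add: alg_power_def)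

definition nil_algebra :: "('v::zero \<Rightarrow> 'v \<Rightarrow> 'v) \<Rightarrow> bool" where
  "nil_algebra mul \<longleftrightarrow> (\<forall>a. \<exists>m\<ge>1. alg_power mul a m = 0)"

definition alg_ideal ::
  "('k::field \<Rightarrow> 'v::ab_group_add \<Rightarrow> 'v) \<Rightarrow> ('v \<Rightarrow> 'v \<Rightarrow> 'v) \<Rightarrow> 'v set \<Rightarrow> bool" where
  "alg_ideal scale mul I \<longleftrightarrow>
     module.subspace scale I \<and> (\<forall>a. \<forall>x\<in>I. mul a x \<in> I \<and> mul x a \<in> I)"

definition is_direct_sum :: "'v::ab_group_add set \<Rightarrow> 'v set \<Rightarrow> bool" where
  "is_direct_sum I J \<longleftrightarrow> I \<inter> J = {0} \<and> (\<forall>x. \<exists>y\<in>I. \<exists>z\<in>J. x = y + z)"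


section \<open>Lie algebras\<close>

locale lie_algebra = vector_space scale
  for scale :: "'k::field \<Rightarrow> 'g::ab_group_add \<Rightarrow> 'g" +
  fixes L :: "'g set"
    and bracket :: "'g \<Rightarrow> 'g \<Rightarrow> 'g"
  assumes subspace_carrier: "subspace L"
    and bracket_closed: "x \<in> L \<Longrightarrow> y \<in> L \<Longrightarrow> bracket x y \<in> L"
    and bracket_add_left:
      "x \<in> L \<Longrightarrow> y \<in> L \<Longrightarrow> z \<in> L \<Longrightarrow> bracket (x + y) z = bracket x z + bracket y z"
    and bracket_add_right:
      "x \<in> L \<Longrightarrow> y \<in> L \<Longrightarrow> z \<in> L \<Longrightarrow> bracket x (y + z) = bracket x y + bracket x z"
    and bracket_scale_left:
      "x \<in> L \<Longrightarrow> y \<in> L \<Longrightarrow> bracket (scale c x) y = scale c (bracket x y)"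
    and bracket_scale_right:
      "x \<in> L \<Longrightarrow> y \<in> L \<Longrightarrow> bracket x (scale c y) = scale c (bracket x y)"
    and bracket_self: "x \<in> L \<Longrightarrow> bracket x x = 0"
    and jacobi:
      "x \<in> L \<Longrightarrow> y \<in> L \<Longrightarrow> z \<in> L \<Longrightarrow>
       bracket x (bracket y z) + bracket y (bracket z x) + bracket z (bracket x y) = 0"

definition lie_algebra_iso ::
  "('k::field \<Rightarrow> 'g::ab_group_add \<Rightarrow> 'g) \<Rightarrow> 'g set \<Rightarrow> ('g \<Rightarrow> 'g \<Rightarrow> 'g) \<Rightarrow>
   ('k \<Rightarrow> 'h::ab_group_add \<Rightarrow> 'h) \<Rightarrow> 'h set \<Rightarrow> ('h \<Rightarrow> 'h \<Rightarrow> 'h) \<Rightarrow> ('g \<Rightarrow> 'h) \<Rightarrow> bool" where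
  "lie_algebra_iso scale1 L1 bracket1 scale2 L2 bracket2 \<phi> \<longleftrightarrow>
     lie_algebra scale1 L1 bracket1 \<and>
     lie_algebra scale2 L2 bracket2 \<and>
     bij_betw \<phi> L1 L2 \<and>
     (\<forall>x\<in>L1. \<forall>y\<in>L1. \<phi> (x + y) = \<phi> x + \<phi> y) \<and>
     (\<forall>c. \<forall>x\<in>L1. \<phi> (scale1 c x) = scale2 c (\<phi> x)) \<and>
     (\<forall>x\<in>L1. \<forall>y\<in>L1. \<phi> (bracket1 x y) = bracket2 (\<phi> x) (\<phi> y))"


section \<open>Linear maps between subspaces, derivations and \<open>Hom\<^sup>0\<close>\<close>

text \<open>
  A linear map \<open>A \<rightarrow> B\<close> between subspaces is represented by its extension by \<open>0\<close> outside \<open>A\<close>,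
  so that equality of functions is equality of maps on \<open>A\<close>, and the representation is stable
  under pointwise sums, scalar multiples and composition. Sums and differences of functions are
  the pointwise ones.
\<close>

definition hom_space ::
  "('k::field \<Rightarrow> 'v::ab_group_add \<Rightarrow> 'v) \<Rightarrow> 'v set \<Rightarrow> 'v set \<Rightarrow> ('v \<Rightarrow> 'v) set" where
  "hom_space scale A B = {h.
     (\<forall>x\<in>A. h x \<in> B) \<and>
     (\<forall>x\<in>A. \<forall>y\<in>A. h (x + y) = h x + h y) \<and>
     (\<forall>c. \<forall>x\<in>A. h (scale c x) = scale c (h x)) \<and>
     (\<forall>x. x \<notin> A \<longrightarrow> h x = 0)}"

definition derivations ::
  "('k::field \<Rightarrow> 'v::ab_group_add \<Rightarrow> 'v) \<Rightarrow> ('v \<Rightarrow> 'v \<Rightarrow> 'v) \<Rightarrow> 'v set \<Rightarrow> ('v \<Rightarrow> 'v) set" where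
  "derivations scale mul A =
     {d \<in> hom_space scale A A. \<forall>u\<in>A. \<forall>v\<in>A. d (mul u v) = mul u (d v) + mul (d u) v}"

definition square ::
  "('k::field \<Rightarrow> 'v::ab_group_add \<Rightarrow> 'v) \<Rightarrow> ('v \<Rightarrow> 'v \<Rightarrow> 'v) \<Rightarrow> 'v set \<Rightarrow> 'v set" where
  "square scale mul I = module.span scale {mul x y | x y. x \<in> I \<and> y \<in> I}"

definition ann :: "('v::zero \<Rightarrow> 'v \<Rightarrow> 'v) \<Rightarrow> 'v set \<Rightarrow> 'v set" where
  "ann mul J = {x \<in> J. \<forall>y\<in>J. mul x y = 0}"

definition hom0 ::
  "('k::field \<Rightarrow> 'v::ab_group_add \<Rightarrow> 'v) \<Rightarrow> ('v \<Rightarrow> 'v \<Rightarrow> 'v) \<Rightarrow>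
   'v set \<Rightarrow> 'v set \<Rightarrow> ('v \<Rightarrow> 'v) set" where
  "hom0 scale mul I J =
     {h \<in> hom_space scale I J. (\<forall>x \<in> square scale mul I. h x = 0) \<and> h ` I \<subseteq> ann mul J}"

definition fun_scale :: "('k \<Rightarrow> 'v \<Rightarrow> 'v) \<Rightarrow> 'k \<Rightarrow> ('v \<Rightarrow> 'v) \<Rightarrow> ('v \<Rightarrow> 'v)" where
  "fun_scale scale c h = (\<lambda>x. scale c (h x))"

text \<open>The parentheses are needed: \<open>\<circ>\<close> binds weaker than \<open>-\<close> and \<open>+\<close>.\<close>

definition commutator :: "('v::ab_group_add \<Rightarrow> 'v) \<Rightarrow> ('v \<Rightarrow> 'v) \<Rightarrow> ('v \<Rightarrow> 'v)" where
  "commutator d d' = (d \<circ> d') - (d' \<circ> d)"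


section \<open>The Lie algebra \<open>L\<^sub>K(\<E>)\<close>\<close>

type_synonym 'v quad = "('v \<Rightarrow> 'v) \<times> ('v \<Rightarrow> 'v) \<times> ('v \<Rightarrow> 'v) \<times> ('v \<Rightarrow> 'v)"

definition LK ::
  "('k::field \<Rightarrow> 'v::ab_group_add \<Rightarrow> 'v) \<Rightarrow> ('v \<Rightarrow> 'v \<Rightarrow> 'v) \<Rightarrow> 'v set \<Rightarrow> 'v set \<Rightarrow> 'v quad set" where
  "LK scale mul I1 I2 =
     derivations scale mul I1 \<times> derivations scale mul I2 \<times>
     hom0 scale mul I1 I2 \<times> hom0 scale mul I2 I1"

fun LK_scale :: "('k \<Rightarrow> 'v \<Rightarrow> 'v) \<Rightarrow> 'k \<Rightarrow> 'v quad \<Rightarrow> 'v quad" where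
  "LK_scale scale c (f, g, l, k) =
     (fun_scale scale c f, fun_scale scale c g, fun_scale scale c l, fun_scale scale c k)"

fun LK_bracket :: "'v::ab_group_add quad \<Rightarrow> 'v quad \<Rightarrow> 'v quad" where
  "LK_bracket (f, g, l, k) (f', g', l', k') =
     (commutator f f' + ((k \<circ> l') - (k' \<circ> l)),
      commutator g g' + ((l \<circ> k') - (l' \<circ> k)),
      ((l \<circ> f') - (l' \<circ> f)) + ((g \<circ> l') - (g' \<circ> l)),
      ((k \<circ> g') - (k' \<circ> g)) + ((f \<circ> k') - (f' \<circ> k)))"

definition component :: "'v::ab_group_add set \<Rightarrow> 'v set \<Rightarrow> 'v \<Rightarrow> 'v" where
  "component I J x = (THE y. y \<in> I \<and> (\<exists>z\<in>J. x = y + z))"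

definition phi :: "'v::ab_group_add set \<Rightarrow> 'v set \<Rightarrow> ('v \<Rightarrow> 'v) \<Rightarrow> 'v quad" where
  "phi I1 I2 d =
     (\<lambda>x. if x \<in> I1 then component I1 I2 (d x) else 0,
      \<lambda>x. if x \<in> I2 then component I2 I1 (d x) else 0,
      \<lambda>x. if x \<in> I1 then component I2 I1 (d x) else 0,
      \<lambda>x. if x \<in> I2 then component I1 I2 (d x) else 0)"

lemma component_eqI:
  assumes vs: "vector_space scale"
    and sub: "module.subspace scale I" "module.subspace scale J"
    and ds: "is_direct_sum I J"
    and "y \<in> I" "z \<in> J" "x = y + z"
  shows "component I J x = y" and "component J I x = z"
proof -
  interpret vector_space scale by (rule vs)
  have uniq: "y = y' \<and> z = z'"
    if "y' \<in> I" "z' \<in> J" "x = y' + z'" for y' z'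
  proof -
    have eq: "y - y' = z' - z"
      using that assms(7) by (simp add: algebra_simps)
    have "y - y' \<in> I" "z' - z \<in> J"
      using that assms by (auto intro: subspace_diff)
    then have "y - y' \<in> I \<inter> J"
      using eq by simp
    then have "y - y' = 0"
      using ds unfolding is_direct_sum_def by blast
    then show ?thesis using eq by simp
  qed
  show "component I J x = y"
    unfolding component_def using assms(5-7) uniq by (intro the_equality) blast+
  show "component J I x = z"
    unfolding component_def
  proof (rule the_equality)
    show "z \<in> J \<and> (\<exists>y\<in>I. x = z + y)"
      using assms(5-7) by (auto simp: add.commute)
  next
    fix z' assume "z' \<in> J \<and> (\<exists>y\<in>I. x = z' + y)"
    then obtain y' where "z' \<in> J" "y' \<in> I" "x = y' + z'"
      by (auto simp: add.commute)
    then show "z' = z" using uniq by blast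
  qed
qed

end

theory Submission
  imports Defs
begin

text \<open>
  Write \<open>p\<^sub>1, p\<^sub>2\<close> for the projections of the algebra onto \<open>I\<^sub>1, I\<^sub>2\<close>. A linear map \<open>d\<close> is a
  \<open>2 \<times> 2\<close> block matrix with entries \<open>p\<^sub>i d\<close> restricted to \<open>I\<^sub>j\<close>, and \<open>phi\<close> lists these entries.
  The point is that the Leibniz rule for \<open>d\<close> splits into separate conditions on the four entries.
  Two ideals with trivial intersection annihilate each other, so the product is computed
  componentwise and the projections are multiplicative. Hence for \<open>u, v\<close> in the same ideal the
  Leibniz rule says that the diagonal entry is a derivation and that the off-diagonal entry kills
  products. For \<open>u \<in> I\<^sub>1\<close> and \<open>v \<in> I\<^sub>2\<close> it reads \<open>0 = u (d v) + (d u) v\<close> with the first summand in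
  \<open>I\<^sub>1\<close> and the second in \<open>I\<^sub>2\<close>, so both vanish: the off-diagonal entries take values in
  annihilators. These are the conditions defining the target
  (\<open>diagonal_block_derivation\<close>, \<open>off_diagonal_block_hom0\<close>). Read backwards, they show that four
  such entries reassemble to a derivation (\<open>glue_derivation\<close>), which inverts \<open>phi\<close>.

  The bracket on quadruples is the commutator of block matrices (\<open>phi_commutator\<close>). So \<open>phi\<close> is a
  linear bijection preserving brackets, and the Lie axioms on the target, including the Jacobi
  identity, are inherited from the derivations (\<open>lie_algebra_image\<close>) instead of being expanded
  for quadruples.
\<close>

section \<open>The Lie algebra of derivations\<close>

lemma vector_space_fun_scale:
  assumes "vector_space scale"
  shows "vector_space (fun_scale scale)"
proof -
  interpret vector_space scale by (rule assms)
  show ?thesis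
    by unfold_locales
      (simp_all add: fun_scale_def fun_eq_iff scale_right_distrib scale_left_distrib)
qed

lemma vector_space_LK_scale:
  assumes "vector_space scale"
  shows "vector_space (LK_scale scale)"
proof -
  interpret F: vector_space "fun_scale scale"
    using assms by (rule vector_space_fun_scale)
  show ?thesis
    by unfold_locales
      (auto simp: F.scale_right_distrib F.scale_left_distrib)
qed

context nonassoc_algebra
begin

lemma mul_zero [simp]: "mul 0 x = 0" "mul x 0 = 0"
  using mul_add_left[of 0 0 x] mul_add_right[of x 0 0] by simp_all

lemma mul_diff: "mul (x - y) z = mul x z - mul y z" "mul z (x - y) = mul z x - mul z y"
  using mul_add_left[of "x - y" y z] mul_add_right[of z "x - y" y] by simp_all

lemma derivation_add: "d \<in> derivations scale mul UNIV \<Longrightarrow> d (x + y) = d x + d y"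
  and derivation_scale: "d \<in> derivations scale mul UNIV \<Longrightarrow> d (scale c x) = scale c (d x)"
  and derivation_mul: "d \<in> derivations scale mul UNIV \<Longrightarrow> d (mul x y) = mul x (d y) + mul (d x) y"
  by (simp_all add: derivations_def hom_space_def)

lemma derivation_diff: "d \<in> derivations scale mul UNIV \<Longrightarrow> d (x - y) = d x - d y"
  using derivation_add[of d "x - y" y] by simp

lemma derivation_zero: "d \<in> derivations scale mul UNIV \<Longrightarrow> d 0 = 0"
  using derivation_diff[of d 0 0] by simp

lemma derivationI:
  assumes "\<And>x y. d (x + y) = d x + d y" "\<And>c x. d (scale c x) = scale c (d x)"
    and "\<And>x y. d (mul x y) = mul x (d y) + mul (d x) y"
  shows "d \<in> derivations scale mul UNIV"
  using assms by (simp add: derivations_def hom_space_def)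

lemma lie_algebra_derivations:
  "lie_algebra (fun_scale scale) (derivations scale mul UNIV) commutator"
proof -
  interpret F: vector_space "fun_scale scale"
    using vector_space_axioms by (rule vector_space_fun_scale)
  note D = derivation_add derivation_scale derivation_mul derivation_diff derivation_zero
  show ?thesis
  proof unfold_locales
    show "F.subspace (derivations scale mul UNIV)"
      by (rule F.subspaceI; rule derivationI)
        (simp_all add: D fun_scale_def mul_add_left mul_add_right mul_scale_left mul_scale_right
          scale_right_distrib mult.commute)
  qed (auto intro!: derivationI simp: fun_eq_iff commutator_def D fun_scale_def mul_add_left
      mul_add_right mul_diff scale_right_distrib scale_right_diff_distrib)
qed

end

section \<open>Transport of a Lie algebra structure\<close>

text \<open>
  All Lie axioms are identities, so they pass to the image of a linear map that preserves brackets.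
\<close>

lemma lie_algebra_image:
  assumes L: "lie_algebra scale1 L bracket1"
    and vs: "vector_space scale2"
    and add: "\<And>x y. x \<in> L \<Longrightarrow> y \<in> L \<Longrightarrow> \<phi> (x + y) = \<phi> x + \<phi> y"
    and scale: "\<And>c x. x \<in> L \<Longrightarrow> \<phi> (scale1 c x) = scale2 c (\<phi> x)"
    and bracket: "\<And>x y. x \<in> L \<Longrightarrow> y \<in> L \<Longrightarrow> \<phi> (bracket1 x y) = bracket2 (\<phi> x) (\<phi> y)"
  shows "lie_algebra scale2 (\<phi> ` L) bracket2"
proof -
  interpret L1: lie_algebra scale1 L bracket1 by (rule L)
  interpret V2: vector_space scale2 by (rule vs)
  note closed = L1.subspace_add[OF L1.subspace_carrier] L1.subspace_scale[OF L1.subspace_carrier]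
    L1.bracket_closed
  have zero_in: "0 \<in> L"
    using L1.subspace_0[OF L1.subspace_carrier] .
  have zero: "\<phi> 0 = 0"
    using add[OF zero_in zero_in] by simp
  show ?thesis
  proof unfold_locales
    show "V2.subspace (\<phi> ` L)"
    proof (rule V2.subspaceI)
      show "0 \<in> \<phi> ` L"
        using imageI[OF zero_in, of \<phi>] by (simp add: zero)
    qed (auto simp flip: add scale simp: closed)
  qed (auto simp flip: add scale bracket
      simp: closed L1.bracket_add_left L1.bracket_add_right L1.bracket_scale_left
        L1.bracket_scale_right L1.bracket_self L1.jacobi zero)
qed

section \<open>Direct sums of two ideals\<close>

locale direct_sum_algebra = nonassoc_algebra scale mul
  for scale :: "'k::field \<Rightarrow> 'v::ab_group_add \<Rightarrow> 'v" and mul +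
  fixes I J :: "'v set"
  assumes ideal_left: "alg_ideal scale mul I"
    and ideal_right: "alg_ideal scale mul J"
    and direct_sum: "is_direct_sum I J"
begin

text \<open>
  The hypotheses are symmetric in the two ideals, so each fact about the first summand is also
  available for the second one.
\<close>

lemma swap: "direct_sum_algebra scale mul J I"
proof unfold_locales
  show "is_direct_sum J I"
    using direct_sum unfolding is_direct_sum_def by (metis Int_commute add.commute)
qed (rule ideal_left ideal_right)+

abbreviation pI where "pI \<equiv> component I J"
abbreviation pJ where "pJ \<equiv> component J I"

lemma subspace_left: "subspace I" and subspace_right: "subspace J"
  using ideal_left ideal_right by (simp_all add: alg_ideal_def)

lemmas left_closed =
  subspace_0[OF subspace_left] subspace_add[OF subspace_left] subspace_scale[OF subspace_left]

lemmas right_closed =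
  subspace_0[OF subspace_right] subspace_add[OF subspace_right] subspace_scale[OF subspace_right]

lemma mul_left: "x \<in> I \<Longrightarrow> mul x a \<in> I" "x \<in> I \<Longrightarrow> mul a x \<in> I"
  and mul_right: "x \<in> J \<Longrightarrow> mul x a \<in> J" "x \<in> J \<Longrightarrow> mul a x \<in> J"
  using ideal_left ideal_right by (auto simp: alg_ideal_def)

lemma eq_zero_of_mem_both: "x \<in> I \<Longrightarrow> x \<in> J \<Longrightarrow> x = 0"
  using direct_sum by (auto simp: is_direct_sum_def)

lemma mul_cross: "x \<in> I \<Longrightarrow> y \<in> J \<Longrightarrow> mul x y = 0" "x \<in> I \<Longrightarrow> y \<in> J \<Longrightarrow> mul y x = 0"
  by (auto intro: eq_zero_of_mem_both mul_left mul_right)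

lemma pI_sum [simp]: "y \<in> I \<Longrightarrow> z \<in> J \<Longrightarrow> pI (y + z) = y"
  and pJ_sum [simp]: "y \<in> I \<Longrightarrow> z \<in> J \<Longrightarrow> pJ (y + z) = z"
  using component_eqI[OF vector_space_axioms subspace_left subspace_right direct_sum] by auto

lemma decompose: obtains y z where "y \<in> I" "z \<in> J" "x = y + z"
  using direct_sum unfolding is_direct_sum_def by blast

lemma pI_in [simp]: "pI x \<in> I" and pJ_in [simp]: "pJ x \<in> J" and pI_pJ: "pI x + pJ x = x"
  by (rule decompose[of x]; simp)+

lemma pI_left [simp]: "x \<in> I \<Longrightarrow> pI x = x" and pJ_left [simp]: "x \<in> I \<Longrightarrow> pJ x = 0"
  using pI_sum[of x 0] pJ_sum[of x 0] by (simp_all add: right_closed)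

lemma pI_add: "pI (x + y) = pI x + pI y"
proof -
  have "pI ((pI x + pI y) + (pJ x + pJ y)) = pI x + pI y"
    by (intro pI_sum left_closed right_closed pI_in pJ_in)
  moreover have "(pI x + pI y) + (pJ x + pJ y) = x + y"
    using pI_pJ[of x] pI_pJ[of y] by (metis add.assoc add.left_commute)
  ultimately show ?thesis by simp
qed

lemma pI_scale: "pI (scale c x) = scale c (pI x)"
proof -
  have "pI (scale c (pI x) + scale c (pJ x)) = scale c (pI x)"
    by (intro pI_sum left_closed right_closed pI_in pJ_in)
  then show ?thesis by (simp add: pI_pJ flip: scale_right_distrib)
qed

lemma mul_split: "mul x y = mul (pI x) (pI y) + mul (pJ x) (pJ y)"
proof -
  have "mul x y = mul (pI x + pJ x) (pI y + pJ y)"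
    by (simp add: pI_pJ)
  then show ?thesis
    by (simp add: mul_add_left mul_add_right mul_cross)
qed

lemma pI_mul: "pI (mul x y) = mul (pI x) (pI y)"
  using mul_split[of x y] by (simp add: mul_left mul_right)

section \<open>The blocks of a derivation\<close>

lemma diagonal_block_derivation:
  assumes d: "d \<in> derivations scale mul UNIV"
  shows "(\<lambda>x. if x \<in> I then pI (d x) else 0) \<in> derivations scale mul I"
  using d
  by (auto simp: derivations_def[of _ _ I] hom_space_def derivation_add derivation_scale
      derivation_mul left_closed mul_left pI_add pI_scale pI_mul)

text \<open>
  Two computations give the two conditions. The \<open>J\<close>-component of the Leibniz rule for \<open>u, v \<in> I\<close>
  says that the block kills products. For \<open>u \<in> I\<close> and \<open>v \<in> J\<close> the Leibniz rule reads
  \<open>0 = u (d v) + (d u) v\<close>; its \<open>J\<close>-component says that the \<open>J\<close>-part of \<open>d u\<close> annihilates \<open>v\<close>.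
\<close>

lemma off_diagonal_block_hom0:
  assumes d: "d \<in> derivations scale mul UNIV"
  shows "(\<lambda>x. if x \<in> I then pJ (d x) else 0) \<in> hom0 scale mul I J" (is "?l \<in> _")
proof -
  interpret S: direct_sum_algebra scale mul J I by (rule swap)
  have hom: "?l \<in> hom_space scale I J"
    using d by (auto simp: hom_space_def derivation_add derivation_scale left_closed S.pI_add
        S.pI_scale)
  have "subspace {x. x \<in> I \<and> pJ (d x) = 0}"
    using d by (auto intro!: subspaceI simp: derivation_add derivation_scale derivation_zero
        left_closed S.pI_add S.pI_scale)
  moreover have "pJ (d (mul u v)) = 0" if "u \<in> I" "v \<in> I" for u v
    using d that by (simp add: derivation_mul S.pI_add S.pI_mul)
  ultimately have "square scale mul I \<subseteq> {x. x \<in> I \<and> pJ (d x) = 0}"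
    unfolding square_def by (intro span_minimal) (auto simp: mul_left)
  moreover have "mul (pJ (d u)) v = 0" if "u \<in> I" "v \<in> J" for u v
  proof -
    have "pJ (mul u (d v) + mul (d u) v) = pJ (d (mul u v))"
      using d by (simp add: derivation_mul)
    also have "\<dots> = 0"
      using d that by (simp add: mul_cross derivation_zero left_closed)
    finally show ?thesis
      using that by (simp add: S.pI_add S.pI_mul)
  qed
  ultimately show ?thesis
    using hom by (auto simp: hom0_def ann_def)
qed

lemma phi_in_LK:
  assumes "d \<in> derivations scale mul UNIV"
  shows "phi I J d \<in> LK scale mul I J"
proof -
  interpret S: direct_sum_algebra scale mul J I by (rule swap)
  show ?thesis
    using assms diagonal_block_derivation S.diagonal_block_derivation
      off_diagonal_block_hom0 S.off_diagonal_block_hom0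
    by (simp add: phi_def LK_def)
qed

section \<open>Reassembling a derivation from its blocks\<close>

fun glue :: "'v quad \<Rightarrow> 'v \<Rightarrow> 'v" where
  "glue (f, g, l, k) x = (f (pI x) + k (pJ x)) + (g (pJ x) + l (pI x))"

lemma glue_phi:
  assumes d: "d \<in> derivations scale mul UNIV"
  shows "glue (phi I J d) = d"
proof
  fix x
  have "d x = d (pI x) + d (pJ x)"
    using d by (simp add: pI_pJ flip: derivation_add)
  also have "\<dots> = (pI (d (pI x)) + pJ (d (pI x))) + (pI (d (pJ x)) + pJ (d (pJ x)))"
    by (simp add: pI_pJ)
  finally show "glue (phi I J d) x = d x"
    by (simp add: phi_def ac_simps)
qed

lemma hom0_apply:
  assumes "h \<in> hom0 scale mul I J"
  shows "h 0 = 0" "x \<in> I \<Longrightarrow> h x \<in> J" "x \<in> I \<Longrightarrow> y \<in> I \<Longrightarrow> h (x + y) = h x + h y"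
    "x \<in> I \<Longrightarrow> h (scale c x) = scale c (h x)" "x \<notin> I \<Longrightarrow> h x = 0"
    "x \<in> I \<Longrightarrow> y \<in> I \<Longrightarrow> h (mul x y) = 0"
    "x \<in> I \<Longrightarrow> y \<in> J \<Longrightarrow> mul (h x) y = 0"
proof -
  have "h (0 + 0) = h 0 + h 0"
    using assms left_closed(1) unfolding hom0_def hom_space_def by blast
  then show "h 0 = 0" by simp
  show "h (mul x y) = 0" if "x \<in> I" "y \<in> I"
  proof -
    have "mul x y \<in> square scale mul I"
      unfolding square_def using that by (intro span_base) auto
    then show ?thesis
      using assms by (simp add: hom0_def)
  qed
qed (use assms in \<open>auto simp: hom0_def hom_space_def ann_def image_subset_iff\<close>)

lemma derivation_left_apply:
  assumes "f \<in> derivations scale mul I"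
  shows "f 0 = 0" "x \<in> I \<Longrightarrow> f x \<in> I" "x \<in> I \<Longrightarrow> y \<in> I \<Longrightarrow> f (x + y) = f x + f y"
    "x \<in> I \<Longrightarrow> f (scale c x) = scale c (f x)" "x \<notin> I \<Longrightarrow> f x = 0"
    "x \<in> I \<Longrightarrow> y \<in> I \<Longrightarrow> f (mul x y) = mul x (f y) + mul (f x) y"
proof -
  have "f (0 + 0) = f 0 + f 0"
    using assms left_closed(1) unfolding derivations_def hom_space_def by blast
  then show "f 0 = 0" by simp
qed (use assms in \<open>auto simp: derivations_def hom_space_def\<close>)

end

text \<open>
  Commutativity enters here: \<open>hom0\<close> demands \<open>ann\<close> only on one side, while the Leibniz rule
  for the glued map has the annihilated factor on either side.
\<close>

locale commutative_direct_sum_algebra = direct_sum_algebra +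
  assumes mul_commute: "mul x y = mul y x"
begin

text \<open>
  The cross terms in \<open>x (d y) + (d x) y\<close> that pair an off-diagonal value with the other factor
  vanish because that value lies in an annihilator, and the off-diagonal blocks vanish on the
  product; what is left is the Leibniz rule for the two diagonal blocks.
\<close>

lemma glue_derivation:
  assumes "q \<in> LK scale mul I J"
  shows "glue q \<in> derivations scale mul UNIV"
proof -
  interpret S: direct_sum_algebra scale mul J I by (rule swap)
  obtain f g l k where q: "q = (f, g, l, k)"
    and f: "f \<in> derivations scale mul I" and g: "g \<in> derivations scale mul J"
    and l: "l \<in> hom0 scale mul I J" and k: "k \<in> hom0 scale mul J I"
    using assms by (auto simp: LK_def)
  note blocks = derivation_left_apply[OF f] S.derivation_left_apply[OF g]
    hom0_apply[OF l] S.hom0_apply[OF k]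
  show ?thesis
    unfolding q
  proof (rule derivationI)
    show "glue (f, g, l, k) (x + y) = glue (f, g, l, k) x + glue (f, g, l, k) y" for x y
      by (simp add: pI_add S.pI_add blocks ac_simps)
    show "glue (f, g, l, k) (scale c x) = scale c (glue (f, g, l, k) x)" for c x
      by (simp add: pI_scale S.pI_scale blocks scale_right_distrib)
    show "glue (f, g, l, k) (mul x y)
        = mul x (glue (f, g, l, k) y) + mul (glue (f, g, l, k) x) y" for x y
    proof -
      have pI: "pI (glue (f, g, l, k) z) = f (pI z) + k (pJ z)"
        and pJ: "pJ (glue (f, g, l, k) z) = g (pJ z) + l (pI z)" for z
        by (simp_all add: blocks left_closed right_closed)
      \<comment> \<open>Here the factor in the annihilator stands on the right.\<close>
      have kill: "mul (pI x) (k (pJ y)) = 0" "mul (pJ x) (l (pI y)) = 0"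
        by (subst mul_commute, simp add: blocks)+
      have "glue (f, g, l, k) (mul x y)
          = (mul (pI x) (f (pI y)) + mul (f (pI x)) (pI y))
            + (mul (pJ x) (g (pJ y)) + mul (g (pJ x)) (pJ y))"
        by (simp add: pI_mul S.pI_mul blocks)
      also have "\<dots> = mul x (glue (f, g, l, k) y) + mul (glue (f, g, l, k) x) y"
        by (simp del: glue.simps add: mul_split[of x] mul_split[of _ y] pI pJ
            mul_add_left mul_add_right blocks kill ac_simps)
      finally show ?thesis .
    qed
  qed
qed

lemma phi_glue:
  assumes "q \<in> LK scale mul I J"
  shows "phi I J (glue q) = q"
proof -
  interpret S: direct_sum_algebra scale mul J I by (rule swap)
  obtain f g l k where q: "q = (f, g, l, k)"
    and f: "f \<in> derivations scale mul I" and g: "g \<in> derivations scale mul J"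
    and l: "l \<in> hom0 scale mul I J" and k: "k \<in> hom0 scale mul J I"
    using assms by (auto simp: LK_def)
  note blocks = derivation_left_apply[OF f] S.derivation_left_apply[OF g]
    hom0_apply[OF l] S.hom0_apply[OF k]
  show ?thesis
    by (auto simp: q phi_def fun_eq_iff blocks left_closed right_closed)
qed

lemma bij_betw_phi: "bij_betw (phi I J) (derivations scale mul UNIV) (LK scale mul I J)"
  by (rule bij_betw_byWitness[where f' = glue])
    (auto simp: glue_phi phi_glue phi_in_LK glue_derivation)

end

section \<open>Compatibility with the brackets\<close>

context direct_sum_algebra
begin

lemma phi_add: "phi I J (d + d') = phi I J d + phi I J d'"
proof -
  interpret S: direct_sum_algebra scale mul J I by (rule swap)
  show ?thesis by (auto simp: phi_def fun_eq_iff pI_add S.pI_add)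
qed

lemma phi_scale: "phi I J (fun_scale scale c d) = LK_scale scale c (phi I J d)"
proof -
  interpret S: direct_sum_algebra scale mul J I by (rule swap)
  show ?thesis by (auto simp: phi_def fun_eq_iff fun_scale_def pI_scale S.pI_scale)
qed

text \<open>
  The bracket of quadruples is the commutator of \<open>2 \<times> 2\<close> block matrices: inserting
  \<open>id = pI + pJ\<close> between the two factors of \<open>d \<circ> d'\<close> is block multiplication.
\<close>

lemma phi_commutator:
  assumes d: "d \<in> derivations scale mul UNIV" and d': "d' \<in> derivations scale mul UNIV"
  shows "phi I J (commutator d d') = LK_bracket (phi I J d) (phi I J d')"
proof -
  interpret S: direct_sum_algebra scale mul J I by (rule swap)
  have pI_diff: "pI (x - y) = pI x - pI y" and pJ_diff: "pJ (x - y) = pJ x - pJ y" for x y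
    using pI_add[of "x - y" y] S.pI_add[of "x - y" y] by (simp_all add: algebra_simps)
  have zero: "pI 0 = 0" "pJ 0 = 0" "d 0 = 0" "d' 0 = 0"
    using d d' by (simp_all add: left_closed derivation_zero)
  have block: "pI (e (e' x)) = pI (e (pI (e' x))) + pI (e (pJ (e' x)))"
    "pJ (e (e' x)) = pJ (e (pI (e' x))) + pJ (e (pJ (e' x)))"
    if "e \<in> derivations scale mul UNIV" for e e' x
  proof -
    have "e (e' x) = e (pI (e' x)) + e (pJ (e' x))"
      using that by (simp add: pI_pJ flip: derivation_add)
    then show "pI (e (e' x)) = pI (e (pI (e' x))) + pI (e (pJ (e' x)))"
      "pJ (e (e' x)) = pJ (e (pI (e' x))) + pJ (e (pJ (e' x)))"
      by (simp_all add: pI_add S.pI_add)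
  qed
  show ?thesis
    unfolding phi_def LK_bracket.simps prod.inject commutator_def
    by (intro conjI ext)
      (simp_all add: pI_diff pJ_diff zero left_closed right_closed
        block[OF d, of d'] block[OF d', of d])
qed

end

theorem proposition3p0p3:
  fixes scale :: "'k::field \<Rightarrow> 'v::ab_group_add \<Rightarrow> 'v"
    and mul :: "'v \<Rightarrow> 'v \<Rightarrow> 'v"
    and I1 I2 :: "'v set"
  assumes "CHAR('k) \<noteq> 2"
    and "evolution_algebra scale mul"
    and "power_associative scale mul"
    and "nil_algebra mul"
    and "alg_ideal scale mul I1" and "alg_ideal scale mul I2"
    and "I1 \<noteq> {0}" and "I2 \<noteq> {0}"
    and "is_direct_sum I1 I2"
  shows "lie_algebra_iso
           (fun_scale scale) (derivations scale mul UNIV) commutator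
           (LK_scale scale) (LK scale mul I1 I2) LK_bracket
           (phi I1 I2)"
proof -
  interpret nonassoc_algebra scale mul
    using assms(2) by (simp add: evolution_algebra_def)
  interpret commutative_direct_sum_algebra scale mul I1 I2
    using assms(2,5,6,9) by unfold_locales (auto simp: evolution_algebra_def)
  note linear = phi_add phi_scale phi_commutator
  have "lie_algebra (LK_scale scale) (phi I1 I2 ` derivations scale mul UNIV) LK_bracket"
    using lie_algebra_derivations vector_space_LK_scale[OF vector_space_axioms]
    by (rule lie_algebra_image) (simp_all add: linear)
  then have "lie_algebra (LK_scale scale) (LK scale mul I1 I2) LK_bracket"
    by (simp add: bij_betw_imp_surj_on[OF bij_betw_phi])
  then show ?thesis
    unfolding lie_algebra_iso_def
    using lie_algebra_derivations bij_betw_phi linear by blast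
qed

end
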